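(* Let $n\ge 1$ be an integer, and suppose the kernel of the game of size $n$ has exactly $k$ elements. Then every configuration of the game of size $n$ that has a solution has exactly $k$ solutions. In particular, if $k > 1$, there exist configurations with no solution.
   Context: For an integer $n\ge 1$, the (triangular Lights Out) game of size $n$ is played on a triangular arrangement of $\beta = n(n+1)/2$ circles ("buttons") with side length $n$: row $r$ ($1\le r\le n$, from top to bottom) contains $r$ buttons, and circles touch as in the usual triangular packing. In coordinates, the buttons are the pairs $(r,s)$ with $1\le s\le r\le n$, and the neighbors of $(r,s)$ (the circles tangent to it) are those among $(r,s-1),(r,s+1),(r-1,s-1),(r-1,s),(r+1,s),(r+1,s+1)$ that belong to the arrangement. Each button is either lit or unlit; a configuration is identified with the set $C$ of lit buttons. Pressing a button switches the state of that button and of all of its neighbors. Since the order of presses is irrelevant and pressing a button twice has no effect, a move is described by a set $X$ of buttons, each pressed once; $C \xrightarrow{X} D$ means that pressing the buttons of $X$ starting from configuration $C$ yields configuration $D$. A set of buttons $X$ is a solution for a configuration $C$ if $C \xrightarrow{X} \emptyset$, i.e. pressing the buttons in $X$ starting from $C$ turns all buttons off. Solutions are counted as sets of buttons. A set of buttons $X$ is a null sequence if $C \xrightarrow{X} C$ for every configuration $C$. The kernel of the game is the set of all null sequences. *)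

theory Defs
  imports Main
begin

type_synonym button = "nat \<times> nat"

definition buttons :: "nat \<Rightarrow> button set" where
  "buttons n = {(r, s). 1 \<le> s \<and> s \<le> r \<and> r \<le> n}"

(* Truncated subtraction is harmless here: a button has r, s \<ge> 1, and a pair with a
   coordinate 0 is not in the arrangement. *)
definition neighbors :: "nat \<Rightarrow> button \<Rightarrow> button set" where
  "neighbors n = (\<lambda>(r, s).
     {(r, s - 1), (r, s + 1), (r - 1, s - 1), (r - 1, s), (r + 1, s), (r + 1, s + 1)} \<inter> buttons n)"

definition configuration :: "nat \<Rightarrow> button set \<Rightarrow> bool" where
  "configuration n C \<longleftrightarrow> C \<subseteq> buttons n"

definition press :: "nat \<Rightarrow> button \<Rightarrow> button set \<Rightarrow> button set" where
  "press n b C = sym_diff C (insert b (neighbors n b))"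

(* The order of presses is irrelevant, so folding press over a finite set is well defined. *)
lemma comp_fun_commute_press: "comp_fun_commute (press n)"
  by unfold_locales (auto simp: press_def fun_eq_iff)

definition leads_to :: "nat \<Rightarrow> button set \<Rightarrow> button set \<Rightarrow> button set \<Rightarrow> bool" where
  "leads_to n C X D \<longleftrightarrow> Finite_Set.fold (press n) C X = D"

definition is_solution :: "nat \<Rightarrow> button set \<Rightarrow> button set \<Rightarrow> bool" where
  "is_solution n C X \<longleftrightarrow> X \<subseteq> buttons n \<and> leads_to n C X {}"

definition null_sequence :: "nat \<Rightarrow> button set \<Rightarrow> bool" where
  "null_sequence n X \<longleftrightarrow> X \<subseteq> buttons n \<and> (\<forall>C. configuration n C \<longrightarrow> leads_to n C X C)"

definition kernel :: "nat \<Rightarrow> button set set" where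
  "kernel n = {X. null_sequence n X}"

end

(*
  Pressing X changes C into the symmetric difference of C and effect n X, and X \<mapsto> effect n X is
  linear over the two-element field. The kernel of the game is the kernel of this map, so the
  solutions of a solvable configuration form a coset of it; and a map from the finite set of sets
  of buttons to itself that is not injective is not surjective.
*)
theory Submission
  imports Defs
begin

text \<open>\<open>card A + card B\<close> counts the intersection twice, so modulo 2 only the
  symmetric difference remains. This is the source of the linearity of
  \<open>effect\<close>.\<close>

lemma odd_card_sym_diff:
  assumes "finite A" "finite B"
  shows "odd (card (sym_diff A B)) \<longleftrightarrow> odd (card A) \<noteq> odd (card B)"
proof -
  have "card (sym_diff A B) = card (A - B) + card (B - A)"
    using assms by (intro card_Un_disjoint) auto
  moreover have "card A = card (A - B) + card (A \<inter> B)"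
    using card_Int_Diff[OF assms(1), of B] by simp
  moreover have "card B = card (B - A) + card (A \<inter> B)"
    using card_Int_Diff[OF assms(2), of A] by (simp add: Int_commute)
  ultimately show ?thesis by auto
qed

definition switched_by :: "nat \<Rightarrow> button \<Rightarrow> button set" where
  "switched_by n b = insert b (neighbors n b)"

text \<open>A button ends up changed exactly when it is switched an odd number of times. As an
  indicator vector this is a matrix product over the two-element field, the column for
  \<open>a\<close> being \<open>switched_by n a\<close>.\<close>

definition effect :: "nat \<Rightarrow> button set \<Rightarrow> button set" where
  "effect n X = {b. odd (card {a \<in> X. b \<in> switched_by n a})}"

lemma effect_empty [simp]: "effect n {} = {}"
  by (simp add: effect_def)

lemma effect_sym_diff:
  assumes "finite X" "finite Y"
  shows "effect n (sym_diff X Y) = sym_diff (effect n X) (effect n Y)"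
proof (rule set_eqI)
  fix b
  let ?S = "\<lambda>Z. {a \<in> Z. b \<in> switched_by n a}"
  have "?S (sym_diff X Y) = sym_diff (?S X) (?S Y)" by blast
  then show "b \<in> effect n (sym_diff X Y) \<longleftrightarrow> b \<in> sym_diff (effect n X) (effect n Y)"
    using odd_card_sym_diff[of "?S X" "?S Y"] assms unfolding effect_def by auto
qed

lemma effect_singleton: "effect n {a} = switched_by n a"
proof -
  have "{x \<in> {a}. b \<in> switched_by n x} = (if b \<in> switched_by n a then {a} else {})" for b
    by auto
  then show ?thesis by (auto simp: effect_def)
qed

lemma fold_press_eq:
  assumes "finite X"
  shows "Finite_Set.fold (press n) C X = sym_diff C (effect n X)"
  using assms
proof (induction X)
  case empty
  then show ?case by simp
next
  case (insert a X)
  interpret press: comp_fun_commute "press n"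
    by (rule comp_fun_commute_press)
  \<comment> \<open>Since \<open>a\<close> is not in \<open>X\<close>, the insertion is a sum over
    the two-element field, so additivity of \<open>effect\<close> applies.\<close>
  have "insert a X = sym_diff {a} X" using insert.hyps by blast
  then have effect: "effect n (insert a X) = sym_diff (switched_by n a) (effect n X)"
    by (simp only: effect_sym_diff insert.hyps finite.intros effect_singleton)
  have "Finite_Set.fold (press n) C (insert a X) =
      press n a (Finite_Set.fold (press n) C X)"
    using insert.hyps by (rule press.fold_insert)
  also have "\<dots> = sym_diff (sym_diff C (effect n X)) (switched_by n a)"
    by (simp only: insert.IH press_def switched_by_def)
  also have "\<dots> = sym_diff C (effect n (insert a X))"
    unfolding effect by blast
  finally show ?case .
qed

lemma finite_buttons: "finite (buttons n)"
  by (rule finite_subset[of _ "{..n} \<times> {..n}"]) (auto simp: buttons_def)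

lemma effect_subset_buttons:
  assumes "X \<subseteq> buttons n"
  shows "effect n X \<subseteq> buttons n"
proof
  fix b assume "b \<in> effect n X"
  \<comment> \<open>An odd cardinality is nonzero, so some pressed button switches \<open>b\<close>;
    that button and its neighbors all lie in the arrangement.\<close>
  then have "{a \<in> X. b \<in> switched_by n a} \<noteq> {}"
    unfolding effect_def by force
  then show "b \<in> buttons n"
    using assms by (auto simp: switched_by_def neighbors_def split: prod.splits)
qed

lemma leads_to_iff:
  assumes "X \<subseteq> buttons n"
  shows "leads_to n C X D \<longleftrightarrow> sym_diff C (effect n X) = D"
  using fold_press_eq[OF finite_subset[OF assms finite_buttons]] by (simp add: leads_to_def)

text \<open>In characteristic two a sum vanishes only if its terms are equal, so switching off
  \<open>C\<close> is the same as producing \<open>C\<close> from the dark board.\<close>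

lemma is_solution_iff: "is_solution n C X \<longleftrightarrow> X \<subseteq> buttons n \<and> effect n X = C"
  using leads_to_iff[of X n C "{}"] unfolding is_solution_def by blast

lemma kernel_eq: "kernel n = {X. X \<subseteq> buttons n \<and> effect n X = {}}"
proof -
  have "null_sequence n X \<longleftrightarrow> X \<subseteq> buttons n \<and> effect n X = {}" for X
  proof
    assume null: "null_sequence n X"
    \<comment> \<open>The dark board alone tests nullity, because the change made by
      \<open>X\<close> does not depend on the starting configuration.\<close>
    then have "leads_to n {} X {}" "X \<subseteq> buttons n"
      by (auto simp: null_sequence_def configuration_def)
    then show "X \<subseteq> buttons n \<and> effect n X = {}" by (simp add: leads_to_iff)
  qed (simp add: null_sequence_def leads_to_iff)
  then show ?thesis by (simp add: kernel_def)
qed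

lemma card_solutions:
  assumes "is_solution n C X"
  shows "card {Y. is_solution n C Y} = card (kernel n)"
proof -
  have shift: "effect n (sym_diff X Y) = sym_diff C (effect n Y)" if "Y \<subseteq> buttons n" for Y
    using effect_sym_diff[of X Y n] that assms finite_subset[OF _ finite_buttons[of n]]
    by (simp add: is_solution_iff)
  have involution: "sym_diff X (sym_diff X Y) = Y" for Y by blast
  \<comment> \<open>Translation by the given solution \<open>X\<close> adds \<open>C\<close> to
    every effect, so it exchanges effect \<open>{}\<close> with effect \<open>C\<close>; being an
    involution, it serves as its own inverse.\<close>
  have "bij_betw (sym_diff X) (kernel n) {Y. is_solution n C Y}"
  proof (rule bij_betw_byWitness[where f' = "sym_diff X"])
    show "sym_diff X ` kernel n \<subseteq> {Y. is_solution n C Y}"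
      using shift assms unfolding kernel_eq is_solution_iff by auto
    show "sym_diff X ` {Y. is_solution n C Y} \<subseteq> kernel n"
      using shift assms unfolding kernel_eq is_solution_iff by auto
  qed (simp_all add: involution)
  then show ?thesis by (simp add: bij_betw_same_card)
qed

lemma exists_unsolvable:
  assumes "card (kernel n) > 1"
  shows "\<exists>C. configuration n C \<and> \<not> (\<exists>X. is_solution n C X)"
proof (rule ccontr)
  assume "\<not> ?thesis"
  then have solvable: "\<exists>X. X \<subseteq> buttons n \<and> effect n X = C" if "C \<subseteq> buttons n" for C
    using that unfolding is_solution_iff configuration_def by metis
  have "effect n ` Pow (buttons n) = Pow (buttons n)"
  proof (intro subset_antisym subsetI)
    fix C assume "C \<in> Pow (buttons n)"
    then obtain X where "X \<subseteq> buttons n" "effect n X = C"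
      using solvable[of C] by auto
    then show "C \<in> effect n ` Pow (buttons n)" by (intro image_eqI[of _ _ X]) auto
  next
    fix C assume "C \<in> effect n ` Pow (buttons n)"
    then show "C \<in> Pow (buttons n)" using effect_subset_buttons by blast
  qed
  \<comment> \<open>The image is all of the finite set \<open>Pow (buttons n)\<close>, so it has as
    many elements as the domain and no two arguments can collide.\<close>
  then have inj: "inj_on (effect n) (Pow (buttons n))"
    by (intro eq_card_imp_inj_on) (simp_all add: finite_buttons)
  \<comment> \<open>The empty set also has empty effect, so injectivity identifies every kernel
    element with it.\<close>
  have "X = {}" if "X \<in> kernel n" for X
    using inj_onD[OF inj, of X "{}"] that by (simp add: kernel_eq)
  then have "kernel n \<subseteq> {{}}" by blast
  then have "card (kernel n) \<le> card {{} :: button set}"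
    by (intro card_mono) simp_all
  with assms show False by simp
qed

theorem mainTheorem3:
  fixes n k :: nat
  assumes "n \<ge> 1" and "card (kernel n) = k"
  shows "(\<forall>C. configuration n C \<longrightarrow> (\<exists>X. is_solution n C X) \<longrightarrow>
            card {X. is_solution n C X} = k) \<and>
         (k > 1 \<longrightarrow> (\<exists>C. configuration n C \<and> \<not> (\<exists>X. is_solution n C X)))"
  using assms(2) card_solutions exists_unsolvable by blast

end
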